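(* Let $n\ge1$ and $n\le N\le 2^n-1$, and let $U$ be the commutative Pauli-$Z$ circuit on $n$ qubits determined by distinct non-empty sets $Q_1,\dots,Q_N\subseteq\{1,\dots,n\}$, with binary matrix $\boldsymbol{A}\in\{0,1\}^{n\times N}$ and lattice volume $V_U$ (see the context). Let $V_{\min}:=2^n$ and $V_{\max}:=(2^n)^{2^{n-1}}$. Then $$V_{\min}\le 2^N\le V_U\le (N+1)^{\frac{N+1}{2}}\le V_{\max}.$$ Moreover, the maximum possible value is attained by the circuit with all rotations: if $N=2^n-1$ then $V_U=V_{\max}$. The minimum possible value is attained by a circuit with $N=n$, and $V_U=V_{\min}$ occurs if and only if $\boldsymbol{A}$ is a square matrix (i.e. $N=n$) of full rank over $\mathbb{Z}_2$.
   Context: Pauli-$Z$ circuit: the initial state is $\psi_0=|+\rangle^{\otimes n}$, i.e. the vector in $\mathbb{C}^{2^n}$ with all entries $2^{-n/2}$. For $j=1,\dots,N$, $H_j=\bigotimes_{m=1}^n O^{(j)}_m$ with $O^{(j)}_m=Z=\mathrm{diag}(1,-1)$ if $m\in Q_j$ and $O^{(j)}_m=I_2$ otherwise, where $Q_1,\dots,Q_N$ are distinct non-empty subsets of $\{1,\dots,n\}$. The circuit is $U(\boldsymbol{\theta})=e^{i(\theta_1H_1+\dots+\theta_NH_N)}$. The matrix $\boldsymbol{A}=(a^{(j)}_m)\in\{0,1\}^{n\times N}$ has $a^{(j)}_m=1$ iff $m\in Q_j$. Lattice volume: write $H_j=\mathrm{diag}(k^{(j)}_1,\dots,k^{(j)}_{2^n})$,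 $\boldsymbol{k}_x=(k_x^{(1)},\dots,k_x^{(N)})$, $\boldsymbol{\Omega}=\{\boldsymbol{k}_x:x=1,\dots,2^n\}$, $\boldsymbol{\Delta}=\{\boldsymbol{k}-\boldsymbol{k}':\boldsymbol{k},\boldsymbol{k}'\in\boldsymbol{\Omega}\}$ and $\mathrm{lat}(W)=\mathrm{span}_{\mathbb{Z}}(\boldsymbol{\Delta})\subseteq\mathbb{Z}^N$ (a lattice of rank $N$). $V_U$ is the volume (covolume) of $\mathrm{lat}(W)$, i.e. the absolute value of the determinant of an $N\times N$ matrix whose rows form a $\mathbb{Z}$-basis of $\mathrm{lat}(W)$. *)

theory Defs
  imports
    Complex_Main
    "HOL-Library.Z2"
    "Jordan_Normal_Form.Matrix"
    "Jordan_Normal_Form.Determinant"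
    "Jordan_Normal_Form.DL_Rank"
begin

(* Qubits and generators are numbered 1..n and 1..N; matrix rows and columns start at 0. *)

definition kronecker :: "'a :: semiring_1 mat \<Rightarrow> 'a mat \<Rightarrow> 'a mat" where
  "kronecker A B = mat (dim_row A * dim_row B) (dim_col A * dim_col B)
     (\<lambda>(i, j). A $$ (i div dim_row B, j div dim_col B) * B $$ (i mod dim_row B, j mod dim_col B))"

definition tensor_list :: "'a :: semiring_1 mat list \<Rightarrow> 'a mat" where
  "tensor_list Ms = foldr kronecker Ms (1\<^sub>m 1)"

definition pauli_Z :: "complex mat" where
  "pauli_Z = mat_of_rows_list 2 [[1, 0], [0, -1]]"

definition pauli_Z_generator :: "nat \<Rightarrow> nat set \<Rightarrow> complex mat" where
  "pauli_Z_generator n S = tensor_list (map (\<lambda>m. if m \<in> S then pauli_Z else 1\<^sub>m 2) [1..<n+1])"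

definition pauli_Z_circuit :: "nat \<Rightarrow> nat \<Rightarrow> (nat \<Rightarrow> nat set) \<Rightarrow> bool" where
  "pauli_Z_circuit n N Q \<longleftrightarrow>
     inj_on Q {1..N} \<and> (\<forall>j \<in> {1..N}. Q j \<noteq> {} \<and> Q j \<subseteq> {1..n})"

definition binary_matrix :: "nat \<Rightarrow> nat \<Rightarrow> (nat \<Rightarrow> nat set) \<Rightarrow> bit mat" where
  "binary_matrix n N Q = mat n N (\<lambda>(m, j). if m + 1 \<in> Q (j + 1) then 1 else 0)"


(* Only meant for matrices with integer diagonal entries. *)
definition int_diag :: "complex mat \<Rightarrow> nat \<Rightarrow> int" where
  "int_diag H x = (THE k. H $$ (x, x) = of_int k)"

definition k_vector :: "nat \<Rightarrow> (nat \<Rightarrow> complex mat) \<Rightarrow> nat \<Rightarrow> int vec" where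
  "k_vector N H x = vec N (\<lambda>j. int_diag (H (j + 1)) x)"

definition Omega :: "nat \<Rightarrow> nat \<Rightarrow> (nat \<Rightarrow> complex mat) \<Rightarrow> int vec set" where
  "Omega d N H = k_vector N H ` {0..<d}"

definition Delta :: "nat \<Rightarrow> nat \<Rightarrow> (nat \<Rightarrow> complex mat) \<Rightarrow> int vec set" where
  "Delta d N H = {k - k' | k k'. k \<in> Omega d N H \<and> k' \<in> Omega d N H}"

abbreviation int_span :: "nat \<Rightarrow> int vec set \<Rightarrow> int vec set" where
  "int_span N \<equiv> LinearCombinations.module.span class_ring (module_vec TYPE(int) N)"

abbreviation int_lin_dep :: "nat \<Rightarrow> int vec set \<Rightarrow> bool" where
  "int_lin_dep N \<equiv> LinearCombinations.module.lin_dep class_ring (module_vec TYPE(int) N)"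

definition lat :: "nat \<Rightarrow> nat \<Rightarrow> (nat \<Rightarrow> complex mat) \<Rightarrow> int vec set" where
  "lat d N H = int_span N (Delta d N H)"

definition is_basis_matrix :: "nat \<Rightarrow> int vec set \<Rightarrow> int mat \<Rightarrow> bool" where
  "is_basis_matrix N L B \<longleftrightarrow> B \<in> carrier_mat N N \<and> distinct (rows B) \<and>
     \<not> int_lin_dep N (set (rows B)) \<and> int_span N (set (rows B)) = L"

(* A value is determined only for lattices of full rank N. *)
definition covolume :: "nat \<Rightarrow> int vec set \<Rightarrow> int" where
  "covolume N L = (THE v. \<exists>B. is_basis_matrix N L B \<and> v = \<bar>det B\<bar>)"

definition lattice_volume :: "nat \<Rightarrow> nat \<Rightarrow> (nat \<Rightarrow> nat set) \<Rightarrow> int" where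
  "lattice_volume n N Q = covolume N (lat (2 ^ n) N (\<lambda>j. pauli_Z_generator n (Q j)))"

definition V_min :: "nat \<Rightarrow> int" where
  "V_min n = 2 ^ n"

definition V_max :: "nat \<Rightarrow> int" where
  "V_max n = (2 ^ n) ^ (2 ^ (n - 1))"

end

theory Submission
  imports Defs
begin

text \<open>Let \<open>chi S X = (-1)^card (S \<inter> X)\<close>. The diagonal entries of the generators are the values of the
  characters \<open>chi (Q j)\<close>, so the lattice is spanned by the vectors \<open>(chi (Q j) X - 1)\<^sub>j\<close> for
  \<open>X \<subseteq> {1..n}\<close>. These are even, whence the lower bound. The lattice has full rank by orthogonality of
  the characters, so some \<open>N\<close> of these vectors have nonzero determinant; it equals the determinant
  of an \<open>(N + 1) \<times> (N + 1)\<close> sign matrix with a column of ones, and Hadamard's inequality gives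
  the upper bound. For \<open>N = 2^n - 1\<close> the sign matrix is the character table, where equality holds.
  Half of the lattice reduces modulo 2 to the row space of the binary matrix, which settles
  the minimum.\<close>

section \<open>Lattices and their bases\<close>

text \<open>The submodule axioms are spelled out with plain vector operations, so that later span
  inclusions need no module locale.\<close>

lemma int_span_least:
  assumes "G \<subseteq> W" "W \<subseteq> carrier_vec N" "0\<^sub>v N \<in> W"
    and "\<And>v w. v \<in> W \<Longrightarrow> w \<in> W \<Longrightarrow> v + w \<in> W"
    and "\<And>c v. v \<in> W \<Longrightarrow> c \<cdot>\<^sub>v v \<in> W"
  shows "int_span N G \<subseteq> W"
proof -
  interpret vec_module "TYPE(int)" N .
  have "submodule class_ring W V"
    using assms by unfold_locales (auto simp: module_vec_simps)
  then show ?thesis using span_is_subset[OF assms(1)] by blast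
qed

lemma int_span_base: "G \<subseteq> carrier_vec N \<Longrightarrow> v \<in> G \<Longrightarrow> v \<in> int_span N G"
proof -
  interpret vec_module "TYPE(int)" N .
  show "G \<subseteq> carrier_vec N \<Longrightarrow> v \<in> G \<Longrightarrow> v \<in> int_span N G"
    using in_own_span by blast
qed

lemma int_span_carrier: "G \<subseteq> carrier_vec N \<Longrightarrow> v \<in> int_span N G \<Longrightarrow> v \<in> carrier_vec N"
proof -
  interpret vec_module "TYPE(int)" N .
  show "G \<subseteq> carrier_vec N \<Longrightarrow> v \<in> int_span N G \<Longrightarrow> v \<in> carrier_vec N"
    using span_is_subset2 by blast
qed

lemma int_span_submodule:
  assumes "G \<subseteq> carrier_vec N"
  shows "submodule class_ring (int_span N G) (module_vec TYPE(int) N)"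
proof -
  interpret vec_module "TYPE(int)" N .
  show ?thesis using span_is_submodule[OF assms] .
qed

lemma int_span_zero: "G \<subseteq> carrier_vec N \<Longrightarrow> 0\<^sub>v N \<in> int_span N G"
  using submodule.zero_closed[OF int_span_submodule, of G N] by (simp add: module_vec_simps)

lemma int_span_add:
  assumes "G \<subseteq> carrier_vec N" "v \<in> int_span N G" "w \<in> int_span N G"
  shows "v + w \<in> int_span N G"
  using submodule.m_closed[OF int_span_submodule, of G N v w] assms by (simp add: module_vec_simps)

lemma int_span_smult:
  assumes "G \<subseteq> carrier_vec N" "v \<in> int_span N G"
  shows "c \<cdot>\<^sub>v v \<in> int_span N G"
  using submodule.smult_closed[OF int_span_submodule, of G N c v] assms by (simp add: module_vec_simps)

text \<open>Combinations are written coordinatewise and indexed by a finite set rather than by the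
  vectors, so that repeated vectors need no special treatment.\<close>

lemma int_span_sum:
  assumes G: "G \<subseteq> carrier_vec N" and "finite A" "\<And>a. a \<in> A \<Longrightarrow> f a \<in> int_span N G"
  shows "vec N (\<lambda>j. \<Sum>a\<in>A. c a * f a $ j) \<in> int_span N G"
  using assms(2,3)
proof (induction A rule: finite_induct)
  case empty
  then show ?case using int_span_zero[OF G] by (simp add: zero_vec_def)
next
  case (insert a A)
  have "f a \<in> carrier_vec N" using insert.prems int_span_carrier[OF G] by blast
  have "vec N (\<lambda>j. \<Sum>a\<in>insert a A. c a * f a $ j) = c a \<cdot>\<^sub>v f a + vec N (\<lambda>j. \<Sum>a\<in>A. c a * f a $ j)"
    using insert.hyps carrier_vecD[OF \<open>f a \<in> carrier_vec N\<close>] by (intro eq_vecI) simp_all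
  also have "\<dots> \<in> int_span N G"
    using insert int_span_smult[OF G] int_span_add[OF G] by auto
  finally show ?case .
qed

text \<open>The product of the row vector \<open>c\<close> with the matrix \<open>B\<close>.\<close>

definition row_comb :: "int mat \<Rightarrow> (nat \<Rightarrow> int) \<Rightarrow> int vec" where
  "row_comb B c = vec (dim_col B) (\<lambda>j. \<Sum>i<dim_row B. c i * B $$ (i, j))"

lemma int_span_rows:
  fixes B :: "int mat"
  assumes B: "B \<in> carrier_mat N N"
  shows "int_span N (set (rows B)) = range (row_comb B)"
    (is "_ = ?R")
proof
  have car: "set (rows B) \<subseteq> carrier_vec N" using B by (auto simp: rows_def)
  have rowB: "row B i \<in> set (rows B)" if "i < N" for i using that B by (auto simp: rows_def)
  show "int_span N (set (rows B)) \<subseteq> ?R"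
  proof (rule int_span_least)
    show "set (rows B) \<subseteq> ?R"
    proof
      fix v assume "v \<in> set (rows B)"
      then obtain r where r: "r < N" "v = row B r" using B by (auto simp: rows_def)
      have "v = row_comb B (\<lambda>i. if i = r then 1 else 0)"
        using r B by (intro eq_vecI) (auto simp: row_comb_def if_distrib[of "\<lambda>x. x * _"] cong: if_cong)
      then show "v \<in> ?R" by blast
    qed
    have "0\<^sub>v N = row_comb B (\<lambda>_. 0)" using B by (auto simp: row_comb_def zero_vec_def)
    then show "0\<^sub>v N \<in> ?R" by blast
    show "v + w \<in> ?R" if vw: "v \<in> ?R" "w \<in> ?R" for v w
    proof -
      obtain c d where "v = row_comb B c" "w = row_comb B d" using vw by auto
      then have "v + w = row_comb B (\<lambda>i. c i + d i)"
        by (intro eq_vecI) (auto simp: row_comb_def sum.distrib distrib_right)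
      then show ?thesis by blast
    qed
    show "a \<cdot>\<^sub>v v \<in> ?R" if v: "v \<in> ?R" for a v
    proof -
      obtain c where "v = row_comb B c" using v by auto
      then have "a \<cdot>\<^sub>v v = row_comb B (\<lambda>i. a * c i)"
        by (intro eq_vecI) (auto simp: row_comb_def sum_distrib_left mult.assoc)
      then show ?thesis by blast
    qed
  qed (use B in \<open>auto simp: row_comb_def\<close>)
  show "?R \<subseteq> int_span N (set (rows B))"
  proof clarify
    fix c
    have "row_comb B c = vec N (\<lambda>j. \<Sum>i<N. c i * row B i $ j)"
      using B by (intro eq_vecI) (auto simp: row_comb_def)
    also have "\<dots> \<in> int_span N (set (rows B))"
      by (rule int_span_sum[OF car]) (auto intro!: int_span_base[OF car] rowB)
    finally show "row_comb B c \<in> int_span N (set (rows B))" .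
  qed
qed

section \<open>Basis matrices and well-definedness of the covolume\<close>

lemma is_basis_matrix_det_dvd:
  assumes B: "is_basis_matrix N L B" and T: "T \<in> carrier_mat N N"
    and TL: "\<And>i. i < N \<Longrightarrow> row T i \<in> L"
  shows "det B dvd det T"
proof -
  have Bc: "B \<in> carrier_mat N N" and span: "int_span N (set (rows B)) = L"
    using B by (auto simp: is_basis_matrix_def)
  have "\<exists>c. row T r = row_comb B c" if "r < N" for r
    using TL[OF that] unfolding span[symmetric] int_span_rows[OF Bc] by blast
  then obtain c where c: "\<And>r. r < N \<Longrightarrow> row T r = row_comb B (c r)"
    by metis
  \<comment> \<open>Expressing the rows of \<open>T\<close> in the basis gives an integer transition
    matrix, so \<open>det B\<close> is a factor of \<open>det T\<close>.\<close>
  define U where "U = mat N N (\<lambda>(r, i). c r i)"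
  have "T = U * B"
  proof (rule eq_matI)
    fix r j assume "r < dim_row (U * B)" "j < dim_col (U * B)"
    then have r: "r < N" and j: "j < N" using Bc by (auto simp: U_def)
    have "T $$ (r, j) = row T r $ j" using r j T by auto
    also have "\<dots> = (U * B) $$ (r, j)"
      using r j Bc by (auto simp: c row_comb_def U_def scalar_prod_def lessThan_atLeast0)
    finally show "T $$ (r, j) = (U * B) $$ (r, j)" .
  qed (use T Bc in \<open>auto simp: U_def\<close>)
  then have "det T = det U * det B" using det_mult[of U N B] Bc by (auto simp: U_def)
  then show ?thesis by simp
qed

lemma is_basis_matrix_rows: "is_basis_matrix N L B \<Longrightarrow> i < N \<Longrightarrow> row B i \<in> L"
proof -
  assume "is_basis_matrix N L B" "i < N"
  then have "set (rows B) \<subseteq> carrier_vec N" "row B i \<in> set (rows B)" "int_span N (set (rows B)) = L"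
    by (auto simp: is_basis_matrix_def rows_def)
  then show "row B i \<in> L" using int_span_base by metis
qed

text \<open>Two bases of one lattice have determinants that divide each other, hence equal absolute
  values; this is the uniqueness that the definite description requires.\<close>

lemma covolume_eq:
  assumes "is_basis_matrix N L B"
  shows "covolume N L = \<bar>det B\<bar>"
  unfolding covolume_def
proof (rule the_equality)
  show "\<exists>B'. is_basis_matrix N L B' \<and> \<bar>det B\<bar> = \<bar>det B'\<bar>" using assms by blast
  fix v assume "\<exists>B'. is_basis_matrix N L B' \<and> v = \<bar>det B'\<bar>"
  then obtain B' where B': "is_basis_matrix N L B'" "v = \<bar>det B'\<bar>" by blast
  have "B \<in> carrier_mat N N" "B' \<in> carrier_mat N N"
    using assms B'(1) unfolding is_basis_matrix_def by blast+
  then have "det B dvd det B'" "det B' dvd det B"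
    using is_basis_matrix_det_dvd[OF assms _ is_basis_matrix_rows[OF B'(1)]]
      is_basis_matrix_det_dvd[OF B'(1) _ is_basis_matrix_rows[OF assms]] by blast+
  then show "v = \<bar>det B\<bar>" using B'(2) zdvd_antisym_abs by blast
qed

text \<open>Equal rows would make the determinant vanish, and over an integral domain a nonzero
  determinant makes the rows independent.\<close>

lemma is_basis_matrixI:
  assumes B: "B \<in> carrier_mat N N" and det: "det B \<noteq> 0" and span: "int_span N (set (rows B)) = L"
  shows "is_basis_matrix N L B"
proof -
  interpret idom_vec N "TYPE(int)" .
  have "rows B ! i \<noteq> rows B ! j" if "i < N" "j < N" "i \<noteq> j" for i j
    using det_identical_rows[OF B that(3,1,2)] det B that by auto
  then have "distinct (rows B)" using B by (auto simp: distinct_conv_nth)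
  then show ?thesis
    using det_not_0_imp_lin_indpt_rows[OF B det] assms by (auto simp: is_basis_matrix_def)
qed

section \<open>Replacing one row, and Cramer's rule\<close>

definition replace_row :: "'a mat \<Rightarrow> nat \<Rightarrow> 'a vec \<Rightarrow> 'a mat" where
  "replace_row B i v = mat (dim_row B) (dim_col B) (\<lambda>(r, c). if r = i then v $ c else B $$ (r, c))"

lemma replace_row_carrier: "B \<in> carrier_mat m n \<Longrightarrow> replace_row B i v \<in> carrier_mat m n"
  by (auto simp: replace_row_def)

lemma row_replace_row:
  "B \<in> carrier_mat m n \<Longrightarrow> r < m \<Longrightarrow> v \<in> carrier_vec n \<Longrightarrow>
    row (replace_row B i v) r = (if r = i then v else row B r)"
  by (intro eq_vecI) (auto simp: replace_row_def)

lemma replace_row_same: "B \<in> carrier_mat m n \<Longrightarrow> i < m \<Longrightarrow> replace_row B i (row B i) = B"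
  by (intro eq_matI) (auto simp: replace_row_def)

text \<open>Laplace expansion along row \<open>i\<close>, whose cofactors do not involve that row.
  The formula exhibits the determinant as a linear functional of \<open>v\<close>.\<close>

lemma det_replace_row:
  assumes B: "B \<in> carrier_mat N N" and i: "i < N"
  shows "det (replace_row B i v) = (\<Sum>j<N. v $ j * cofactor B i j)"
proof -
  have "det (replace_row B i v) =
      (\<Sum>j<N. replace_row B i v $$ (i, j) * cofactor (replace_row B i v) i j)"
    by (rule laplace_expansion_row[OF replace_row_carrier[OF B] i])
  also have "\<dots> = (\<Sum>j<N. v $ j * cofactor B i j)"
  proof (rule sum.cong[OF refl])
    fix j assume j: "j \<in> {..<N}"
    have "mat_delete (replace_row B i v) i j = mat_delete B i j"
      using B i j by (intro eq_matI) (auto simp: mat_delete_def replace_row_def)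
    then show "replace_row B i v $$ (i, j) * cofactor (replace_row B i v) i j = v $ j * cofactor B i j"
      using B i j by (simp add: cofactor_def) (simp add: replace_row_def)
  qed
  finally show ?thesis .
qed

text \<open>By \<open>det_replace_row\<close> the determinants are the entries of
  \<open>v * adj_mat B\<close>, so this is \<open>v * adj_mat B * B = det B * v\<close> read
  entrywise. No division occurs, which makes it usable over the integers.\<close>

lemma cramer_row:
  fixes B :: "'a :: comm_ring_1 mat"
  assumes B: "B \<in> carrier_mat N N" and c: "c < N"
  shows "(\<Sum>i<N. det (replace_row B i v) * B $$ (i, c)) = det B * v $ c"
proof -
  have adj: "(\<Sum>i<N. cofactor B i j * B $$ (i, c)) = (if j = c then det B else 0)" if j: "j < N" for j
  proof -
    have "(adj_mat B * B) $$ (j, c) = (\<Sum>i<N. cofactor B i j * B $$ (i, c))"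
      using B j c by (auto simp: adj_mat_def scalar_prod_def lessThan_atLeast0)
    then show ?thesis using adj_mat(3)[OF B] j c by auto
  qed
  have "(\<Sum>i<N. det (replace_row B i v) * B $$ (i, c)) =
      (\<Sum>i<N. \<Sum>j<N. v $ j * (cofactor B i j * B $$ (i, c)))"
    by (intro sum.cong refl) (simp add: det_replace_row[OF B] sum_distrib_right mult.assoc)
  also have "\<dots> = (\<Sum>j<N. v $ j * (\<Sum>i<N. cofactor B i j * B $$ (i, c)))"
    by (subst sum.swap) (simp add: sum_distrib_left)
  also have "\<dots> = (\<Sum>j<N. v $ j * (if j = c then det B else 0))"
    by (intro sum.cong refl) (simp add: adj)
  also have "\<dots> = det B * v $ c"
    using c by (simp add: if_distrib[of "\<lambda>x. _ * x"] mult.commute cong: if_cong)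
  finally show ?thesis .
qed

text \<open>A tuple of lattice vectors whose determinant is nonzero and of least absolute value is a basis:
  by Cramer's rule the coordinates of a lattice vector are quotients of determinants, and a nonzero
  remainder of such a division would be a smaller determinant.\<close>

lemma full_rank_basis_exists:
  assumes G: "G \<subseteq> carrier_vec N" and T: "T \<in> carrier_mat N N" "det T \<noteq> 0"
    and TL: "\<And>i. i < N \<Longrightarrow> row T i \<in> int_span N G"
  obtains B where "is_basis_matrix N (int_span N G) B" "det B \<noteq> 0"
proof -
  let ?L = "int_span N G"
  let ?P = "\<lambda>B. B \<in> carrier_mat N N \<and> det B \<noteq> 0 \<and> (\<forall>i<N. row B i \<in> ?L)"
  have "?P T" using T TL by blast
  then obtain B where PB: "?P B" and min: "\<And>B'. ?P B' \<Longrightarrow> nat \<bar>det B\<bar> \<le> nat \<bar>det B'\<bar>"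
    using ex_has_least_nat[of ?P T "\<lambda>B. nat \<bar>det B\<bar>"] by blast
  then have B: "B \<in> carrier_mat N N" and d: "det B \<noteq> 0" and rows: "\<And>i. i < N \<Longrightarrow> row B i \<in> ?L"
    by auto
  have dvd: "det B dvd det (replace_row B i v)" if v: "v \<in> ?L" and i: "i < N" for i v
  proof (rule ccontr)
    assume ndvd: "\<not> ?thesis"
    \<comment> \<open>Division with remainder on determinants: subtracting \<open>q\<close> copies
      of row \<open>i\<close> from \<open>v\<close> lowers the determinant by
      \<open>q * det B\<close>.\<close>
    define q where "q = det (replace_row B i v) div det B"
    define w where "w = v + (- q) \<cdot>\<^sub>v row B i"
    have vc: "v \<in> carrier_vec N" by (rule int_span_carrier[OF G v])
    have w: "w \<in> ?L" unfolding w_def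
      by (intro int_span_add[OF G] int_span_smult[OF G] v rows i)
    have "det (replace_row B i w) = det (replace_row B i v) - q * det (replace_row B i (row B i))"
      using vc B i unfolding det_replace_row[OF B i]
      by (simp add: w_def sum_subtractf[symmetric] sum_distrib_left left_diff_distrib mult.assoc)
    also have "\<dots> = det (replace_row B i v) mod det B"
      by (simp add: replace_row_same[OF B i] q_def minus_div_mult_eq_mod)
    finally have det_w: "det (replace_row B i w) = det (replace_row B i v) mod det B" .
    have "?P (replace_row B i w)"
      using det_w ndvd w rows B replace_row_carrier[OF B] row_replace_row[OF B _ int_span_carrier[OF G w]]
      by (auto simp: mod_eq_0_iff_dvd)
    from min[OF this] have "\<bar>det B\<bar> \<le> \<bar>det (replace_row B i v) mod det B\<bar>" by (simp add: det_w)
    then show False using abs_mod_less[OF d] by (meson not_le)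
  qed
  have car: "set (rows B) \<subseteq> carrier_vec N" using B by (auto simp: rows_def)
  have "int_span N (set (rows B)) = ?L"
  proof
    show "int_span N (set (rows B)) \<subseteq> ?L"
    proof (rule int_span_least)
      show "set (rows B) \<subseteq> ?L" using rows B by (auto simp: rows_def)
    qed (auto intro: int_span_add[OF G] int_span_smult[OF G] int_span_zero[OF G] int_span_carrier[OF G])
    show "?L \<subseteq> int_span N (set (rows B))"
    proof
      fix v assume v: "v \<in> ?L"
      have vc: "v \<in> carrier_vec N" by (rule int_span_carrier[OF G v])
      have "v = row_comb B (\<lambda>i. det (replace_row B i v) div det B)"
      proof (rule eq_vecI)
        fix j assume "j < dim_vec (row_comb B (\<lambda>i. det (replace_row B i v) div det B))"
        then have j: "j < N" using B by (simp add: row_comb_def)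
        have "det B * (\<Sum>i<N. (det (replace_row B i v) div det B) * B $$ (i, j)) = det B * v $ j"
          unfolding cramer_row[OF B j, symmetric] sum_distrib_left
          by (intro sum.cong refl) (simp add: dvd[OF v] mult.assoc[symmetric])
        then show "v $ j = row_comb B (\<lambda>i. det (replace_row B i v) div det B) $ j"
          using d j B by (simp add: row_comb_def)
      qed (use vc B in \<open>auto simp: row_comb_def\<close>)
      then show "v \<in> int_span N (set (rows B))" unfolding int_span_rows[OF B] by blast
    qed
  qed
  then show thesis using that is_basis_matrixI[OF B d] d by blast
qed

text \<open>Steinitz exchange with determinants: the rows are replaced by elements of
  \<open>G\<close> one at a time, keeping the determinant nonzero and all rows in the span.\<close>

lemma exchange_rows:
  assumes G: "G \<subseteq> carrier_vec N" and T: "T \<in> carrier_mat N N" "det T \<noteq> 0"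
    and TL: "\<And>i. i < N \<Longrightarrow> row T i \<in> int_span N G"
  obtains B where "B \<in> carrier_mat N N" "det B \<noteq> 0" "\<And>i. i < N \<Longrightarrow> row B i \<in> G"
proof -
  have "\<exists>B \<in> carrier_mat N N. det B \<noteq> 0 \<and> (\<forall>i<k. row B i \<in> G) \<and> (\<forall>i<N. row B i \<in> int_span N G)"
    if "k \<le> N" for k
    using that
  proof (induction k)
    case 0
    then show ?case using T TL by blast
  next
    case (Suc k)
    then obtain B where B: "B \<in> carrier_mat N N" "det B \<noteq> 0" "\<And>i. i < k \<Longrightarrow> row B i \<in> G"
        "\<And>i. i < N \<Longrightarrow> row B i \<in> int_span N G"
      by auto
    have k: "k < N" using Suc.prems by simp
    have "\<exists>g\<in>G. det (replace_row B k g) \<noteq> 0"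
    proof (rule ccontr)
      assume "\<not> ?thesis"
      \<comment> \<open>The vectors at which this linear functional vanishes form a submodule; if it
        contained \<open>G\<close>, it would contain row \<open>k\<close> of \<open>B\<close>,
        contradicting \<open>det B \<noteq> 0\<close>.\<close>
      then have "int_span N G \<subseteq> {v \<in> carrier_vec N. det (replace_row B k v) = 0}"
        using G unfolding det_replace_row[OF B(1) k]
        by (intro int_span_least)
          (auto simp: distrib_right sum.distrib mult.assoc simp flip: sum_distrib_left)
      then show False using B(4)[OF k] B(2) replace_row_same[OF B(1) k] by auto
    qed
    then obtain g where g: "g \<in> G" "det (replace_row B k g) \<noteq> 0" by blast
    have gc: "g \<in> carrier_vec N" using g G by blast
    show ?case
      using g B k row_replace_row[OF B(1) _ gc] int_span_base[OF G g(1)]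
      by (intro bexI[OF _ replace_row_carrier[OF B(1), of k g]]) (auto simp: less_Suc_eq)
  qed
  from this[of N] show thesis using that by blast
qed

section \<open>Hadamard's inequality\<close>

text \<open>One step of Gaussian elimination, written as \<open>A = L * U\<close> with
  \<open>L\<close> unit lower triangular and the first column of \<open>U\<close> cleared below the
  corner.\<close>

lemma det_schur_complement:
  fixes A :: "'a :: field mat"
  assumes A: "A \<in> carrier_mat (Suc n) (Suc n)" and a: "A $$ (0, 0) \<noteq> 0"
  shows "det A = A $$ (0, 0) *
    det (mat n n (\<lambda>(i, j). A $$ (Suc i, Suc j) - A $$ (Suc i, 0) * A $$ (0, Suc j) / A $$ (0, 0)))"
    (is "_ = _ * det ?C")
proof -
  define L where "L = mat (Suc n) (Suc n)
    (\<lambda>(i, j). if i = j then 1 else if j = 0 then A $$ (i, 0) / A $$ (0, 0) else 0)"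
  define U where "U = mat (Suc n) (Suc n)
    (\<lambda>(i, j). if i = 0 then A $$ (0, j) else if j = 0 then 0 else ?C $$ (i - 1, j - 1))"
  have Lc: "L \<in> carrier_mat (Suc n) (Suc n)" and Uc: "U \<in> carrier_mat (Suc n) (Suc n)"
    by (auto simp: L_def U_def)
  have "A = L * U"
  proof (rule eq_matI)
    fix i j assume "i < dim_row (L * U)" "j < dim_col (L * U)"
    then have i: "i < Suc n" and j: "j < Suc n" using Lc Uc by auto
    have "(L * U) $$ (i, j) = (\<Sum>k<Suc n. L $$ (i, k) * U $$ (k, j))"
      using i j Lc Uc by (simp add: scalar_prod_def lessThan_atLeast0)
    \<comment> \<open>Row \<open>i\<close> of \<open>L\<close> can be nonzero only at
      \<open>k = i\<close> and \<open>k = 0\<close>. For \<open>i = 0\<close> these coincide, and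
      the second term is set to 0 so as not to count it twice.\<close>
    also have "\<dots> = (\<Sum>k<Suc n. (if k = i then U $$ (i, j) else 0)
        + (if k = 0 then (if i = 0 then 0 else A $$ (i, 0) / A $$ (0, 0) * A $$ (0, j)) else 0))"
      using i j by (intro sum.cong) (auto simp: L_def U_def)
    also have "\<dots> = U $$ (i, j) + (if i = 0 then 0 else A $$ (i, 0) / A $$ (0, 0) * A $$ (0, j))"
      using i unfolding sum.distrib by (simp only: sum.delta finite_lessThan) simp
    also have "\<dots> = A $$ (i, j)"
      using i j a by (cases i; cases j) (auto simp: U_def)
    finally show "A $$ (i, j) = (L * U) $$ (i, j)" by simp
  qed (use A Lc Uc in auto)
  moreover have "det L = 1"
    by (subst det_lower_triangular[OF _ Lc])
      (auto simp: L_def prod_list_diag_prod intro!: prod.neutral)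
  moreover have "det U = A $$ (0, 0) * det ?C"
  proof -
    have "det U = (\<Sum>i<Suc n. U $$ (i, 0) * cofactor U i 0)"
      by (rule laplace_expansion_column[OF Uc]) simp
    also have "\<dots> = (\<Sum>i<Suc n. if i = 0 then A $$ (0, 0) * cofactor U 0 0 else 0)"
      by (intro sum.cong) (auto simp: U_def)
    also have "\<dots> = A $$ (0, 0) * cofactor U 0 0" by (simp only: sum.delta finite_lessThan) simp
    also have "mat_delete U 0 0 = ?C"
      by (intro eq_matI) (auto simp: mat_delete_def U_def)
    then have "cofactor U 0 0 = det ?C" by (simp add: cofactor_def)
    finally show ?thesis .
  qed
  ultimately show ?thesis using det_mult[OF Lc Uc] by simp
qed

text \<open>The Schur complement of the first entry of a Gram matrix is the Gram matrix of the projections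
  of the remaining vectors to the orthogonal complement of the first one.\<close>

lemma gram_det_le:
  fixes v :: "nat \<Rightarrow> nat \<Rightarrow> real"
  shows "det (mat n n (\<lambda>(i, j). \<Sum>k<m. v i k * v j k)) \<le> (\<Prod>i<n. \<Sum>k<m. (v i k)\<^sup>2)"
proof (induction n arbitrary: v)
  case 0
  then show ?case by (simp add: det_def)
next
  case (Suc n)
  define ip where "ip x y = (\<Sum>k<m. x k * y k)" for x y :: "nat \<Rightarrow> real"
  define A where "A = mat (Suc n) (Suc n) (\<lambda>(i, j). ip (v i) (v j))"
  have Ac: "A \<in> carrier_mat (Suc n) (Suc n)" by (simp add: A_def)
  have A: "A $$ (i, j) = ip (v i) (v j)" if "i < Suc n" "j < Suc n" for i j
    using that by (simp add: A_def)
  have sq: "(\<Sum>k<m. (x k)\<^sup>2) = ip x x" for x by (simp add: ip_def power2_eq_square)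
  have nonneg: "0 \<le> ip x x" for x unfolding sq[symmetric] by (simp add: sum_nonneg)
  \<comment> \<open>If the first vector is zero, so is the first row of the Gram matrix; otherwise
    its squared length serves as pivot.\<close>
  show ?case
  proof (cases "ip (v 0) (v 0) = 0")
    case True
    then have "\<forall>k<m. v 0 k = 0"
      unfolding sq[symmetric] by (subst (asm) sum_nonneg_eq_0_iff) auto
    then have "ip (v 0) x = 0" for x by (simp add: ip_def)
    then have "det A = 0"
      unfolding laplace_expansion_row[OF Ac zero_less_Suc] by (intro sum.neutral) (simp add: A)
    then show ?thesis
      unfolding sq by (simp add: A_def ip_def[symmetric] prod_nonneg nonneg)
  next
    case False
    define a where "a = ip (v 0) (v 0)"
    have a: "a > 0" using False nonneg[of "v 0"] by (simp add: a_def)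
    define w where "w i k = v (Suc i) k - ip (v (Suc i)) (v 0) / a * v 0 k" for i k
    have ip_w: "ip (w i) (w j) =
        ip (v (Suc i)) (v (Suc j)) - ip (v (Suc i)) (v 0) * ip (v 0) (v (Suc j)) / a" for i j
    proof -
      define c where "c i = ip (v (Suc i)) (v 0) / a" for i
      have w: "w i k = v (Suc i) k - c i * v 0 k" for i k by (simp add: w_def c_def)
      have comm: "ip x y = ip y x" for x y by (simp add: ip_def mult.commute)
      have "ip (w i) (w j) = ip (v (Suc i)) (v (Suc j)) - c j * ip (v (Suc i)) (v 0)
          - c i * ip (v 0) (v (Suc j)) + c i * c j * a"
        unfolding w ip_def a_def
        by (simp add: sum_distrib_left sum_subtractf[symmetric] sum.distrib[symmetric] algebra_simps)
      also have "c i * c j * a = c j * ip (v (Suc i)) (v 0)" using a by (simp add: c_def)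
      finally show ?thesis by (simp add: c_def comm[of _ "v 0"])
    qed
    have "det A = a * det (mat n n (\<lambda>(i, j). ip (w i) (w j)))"
      using False unfolding a_def by (subst det_schur_complement[OF Ac])
        (auto simp: A ip_w a_def intro!: arg_cong[of _ _ det] eq_matI)
    also have "\<dots> \<le> a * (\<Prod>i<n. ip (w i) (w i))"
      using Suc.IH[of w] a unfolding sq by (simp add: ip_def)
    \<comment> \<open>Projecting does not lengthen a vector: for \<open>i = j\<close> a nonnegative
      quantity is subtracted in \<open>ip_w\<close>.\<close>
    also have "(\<Prod>i<n. ip (w i) (w i)) \<le> (\<Prod>i<n. ip (v (Suc i)) (v (Suc i)))"
    proof (intro prod_mono conjI)
      fix i
      have "0 \<le> ip (v (Suc i)) (v 0) * ip (v (Suc i)) (v 0) / a" using a by simp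
      moreover have "ip (v (Suc i)) (v 0) = ip (v 0) (v (Suc i))" by (simp add: ip_def mult.commute)
      ultimately show "ip (w i) (w i) \<le> ip (v (Suc i)) (v (Suc i))"
        unfolding ip_w by simp
    qed (rule nonneg)
    finally have "det A \<le> a * (\<Prod>i<n. ip (v (Suc i)) (v (Suc i)))" using a by simp
    then show ?thesis
      unfolding sq by (simp add: A_def ip_def[symmetric] a_def prod.lessThan_Suc_shift del: prod.lessThan_Suc)
  qed
qed

text \<open>\<open>A * A\<^sup>T\<close> is the Gram matrix of the rows of \<open>A\<close>, and its
  determinant is the square of \<open>det A\<close>.\<close>

lemma hadamard_inequality:
  fixes A :: "real mat"
  assumes A: "A \<in> carrier_mat n n"
  shows "(det A)\<^sup>2 \<le> (\<Prod>i<n. \<Sum>k<n. (A $$ (i, k))\<^sup>2)"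
proof -
  have "(det A)\<^sup>2 = det (A * A\<^sup>T)"
    using A by (simp add: det_mult[of _ n] det_transpose power2_eq_square)
  also have "A * A\<^sup>T = mat n n (\<lambda>(i, j). \<Sum>k<n. A $$ (i, k) * A $$ (j, k))"
    using A by (intro eq_matI) (auto simp: scalar_prod_def lessThan_atLeast0)
  finally show ?thesis using gram_det_le[where n = n and m = n and v = "\<lambda>i k. A $$ (i, k)"] by simp
qed

text \<open>With a first column of ones the pivot is 1 and the Schur complement consists of the row
  differences. The elimination step is stated over fields, hence the passage through the
  reals.\<close>

lemma det_subtract_first_row:
  fixes M :: "int mat"
  assumes M: "M \<in> carrier_mat (Suc N) (Suc N)" and "\<And>i. i \<le> N \<Longrightarrow> M $$ (i, 0) = 1"
  shows "det (mat N N (\<lambda>(i, j). M $$ (Suc i, Suc j) - M $$ (0, Suc j))) = det M"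
proof -
  let ?M = "map_mat real_of_int M"
  have "det ?M = det (mat N N (\<lambda>(i, j). ?M $$ (Suc i, Suc j) - ?M $$ (0, Suc j)))"
    using assms by (subst det_schur_complement[of ?M N])
      (auto intro!: arg_cong[of _ _ det] eq_matI)
  also have "mat N N (\<lambda>(i, j). ?M $$ (Suc i, Suc j) - ?M $$ (0, Suc j)) =
      map_mat real_of_int (mat N N (\<lambda>(i, j). M $$ (Suc i, Suc j) - M $$ (0, Suc j)))"
    using M by (intro eq_matI) auto
  finally show ?thesis by (simp add: of_int_hom.hom_det)
qed

section \<open>Characters and the lattice of the circuit\<close>

text \<open>On finite sets under symmetric difference, \<open>chi S\<close> is the character of the
  group that is indexed by \<open>S\<close>.\<close>

definition chi :: "nat set \<Rightarrow> nat set \<Rightarrow> int" where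
  "chi S X = (\<Prod>m\<in>X. if m \<in> S then -1 else 1)"

lemma chi_empty [simp]: "chi S {} = 1" "chi {} X = 1"
  by (simp_all add: chi_def)

text \<open>Translates signs into parities: for \<open>S = Q j\<close> and \<open>X\<close> within
  \<open>{1..n}\<close>, the sum over \<open>bit\<close> adds up the entries that the rows in
  \<open>X\<close> have in the column of \<open>Q j\<close> of the binary matrix.\<close>

lemma chi_parity:
  "finite X \<Longrightarrow> chi S X = (if (\<Sum>m\<in>X. if m \<in> S then 1 else 0 :: bit) = 0 then 1 else -1)"
  by (induction X rule: finite_induct) (auto simp: chi_def)

lemma chi_square [simp]: "finite X \<Longrightarrow> (chi S X)\<^sup>2 = 1"
  by (simp add: chi_parity)

text \<open>The sum over all subsets factors into one two-term factor per element of
  \<open>F\<close>; a point in exactly one of \<open>S\<close> and \<open>T\<close> gives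
  \<open>-1 + 1 = 0\<close>, and for \<open>S = T\<close> all factors are 2.\<close>

lemma sum_chi_mult_chi:
  assumes F: "finite F" and "S \<subseteq> F" "T \<subseteq> F"
  shows "(\<Sum>X\<in>Pow F. chi S X * chi T X) = (if S = T then 2 ^ card F else 0)"
proof -
  let ?s = "\<lambda>S m. if m \<in> S then -1 else 1 :: int"
  have "(\<Sum>X\<in>Pow F. chi S X * chi T X) = (\<Prod>m\<in>F. ?s S m * ?s T m + 1)"
    unfolding prod_add[OF F] chi_def prod.distrib by simp
  also have "\<dots> = (if S = T then 2 ^ card F else 0)"
  proof (cases "S = T")
    case True
    then have "(\<Prod>m\<in>F. ?s S m * ?s T m + 1) = (\<Prod>m\<in>F. 2)"
      by (intro prod.cong) auto
    then show ?thesis using True by simp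
  next
    case False
    then obtain m where "m \<in> F" "(m \<in> S) \<noteq> (m \<in> T)" using assms(2,3) by blast
    then have "(\<Prod>m\<in>F. ?s S m * ?s T m + 1) = 0" using F by (intro prod_zero) auto
    then show ?thesis using False by simp
  qed
  finally show ?thesis .
qed

text \<open>The tensor factors are ordered from the most significant bit of the row index downwards.\<close>

definition support :: "nat \<Rightarrow> nat \<Rightarrow> nat set" where
  "support n x = {m \<in> {1..n}. bit x (n - m)}"

lemma support_0 [simp]: "support n 0 = {}"
  by (simp add: support_def)

text \<open>The \<open>n\<close> lowest bits determine a number below \<open>2 ^ n\<close>, which
  gives injectivity; surjectivity follows by counting.\<close>

lemma bij_betw_support: "bij_betw (support n) {0..<2 ^ n} (Pow {1..n})"
proof -
  have inj: "inj_on (support n) {0..<2 ^ n}"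
  proof (rule inj_onI)
    fix x y :: nat
    assume x: "x \<in> {0..<2 ^ n}" and y: "y \<in> {0..<2 ^ n}" and eq: "support n x = support n y"
    show "x = y"
    proof (rule bit_eqI)
      fix i
      show "bit x i = bit y i"
      proof (cases "i < n")
        case True
        then have "bit z i \<longleftrightarrow> n - i \<in> support n z" for z by (auto simp: support_def)
        then show ?thesis using eq by simp
      next
        case False
        then have "z < 2 ^ n \<Longrightarrow> \<not> bit z i" for z :: nat
          by (metis bit_take_bit_iff take_bit_nat_eq_self)
        then show ?thesis using x y by auto
      qed
    qed
  qed
  have "support n ` {0..<2 ^ n} = Pow {1..n}"
  proof (rule card_subset_eq)
    show "card (support n ` {0..<2 ^ n}) = card (Pow {1..n})"
      by (simp add: card_image[OF inj] card_Pow)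
  qed (auto simp: support_def)
  then show ?thesis using inj by (simp add: bij_betw_def)
qed

text \<open>Induction on the number \<open>k\<close> of trailing tensor factors. The new leftmost
  factor belongs to qubit \<open>n - k\<close> and is selected by bit \<open>k\<close> of the index,
  while the remaining factors see the index modulo \<open>2 ^ k\<close>.\<close>

lemma tensor_list_pauli:
  fixes S :: "nat set"
  assumes "k \<le> n"
  defines "T \<equiv> tensor_list (map (\<lambda>m. if m \<in> S then pauli_Z else 1\<^sub>m 2) [Suc n - k..<Suc n])"
  shows "dim_row T = 2 ^ k \<and> dim_col T = 2 ^ k \<and> (\<forall>x<2 ^ k. T $$ (x, x) =
    of_int (chi S {m \<in> {Suc n - k..n}. bit x (n - m)}))"
  using assms(1) unfolding T_def
proof (induction k)
  case 0
  then show ?case by (auto simp: tensor_list_def)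
next
  case (Suc k)
  define T where "T = tensor_list (map (\<lambda>m. if m \<in> S then pauli_Z else 1\<^sub>m 2) [Suc n - k..<Suc n])"
  define D where "D = (if n - k \<in> S then pauli_Z else 1\<^sub>m 2)"
  have IH: "dim_row T = 2 ^ k" "dim_col T = 2 ^ k"
    "\<And>x. x < 2 ^ k \<Longrightarrow> T $$ (x, x) = of_int (chi S {m \<in> {Suc n - k..n}. bit x (n - m)})"
    using Suc by (auto simp: T_def)
  have "[Suc n - Suc k..<Suc n] = (n - k) # [Suc n - k..<Suc n]"
    using Suc.prems by (subst upt_conv_Cons) (auto simp: Suc_diff_le)
  then have T': "tensor_list (map (\<lambda>m. if m \<in> S then pauli_Z else 1\<^sub>m 2) [Suc n - Suc k..<Suc n]) = kronecker D T"
    by (simp add: tensor_list_def T_def D_def)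
  have D: "dim_row D = 2" "dim_col D = 2" by (auto simp: D_def pauli_Z_def mat_of_rows_list_def)
  have diag: "D $$ (i, i) = (if i = 1 \<and> n - k \<in> S then -1 else 1)" if "i < 2" for i
    using that by (auto simp: D_def pauli_Z_def mat_of_rows_list_def less_2_cases_iff)
  have "kronecker D T $$ (x, x) = of_int (chi S {m \<in> {Suc n - Suc k..n}. bit x (n - m)})"
    if x: "x < 2 ^ Suc k" for x
  proof -
    let ?X = "{m \<in> {Suc n - k..n}. bit (x mod 2 ^ k) (n - m)}"
    have div: "x div 2 ^ k < 2" using x by (simp add: less_mult_imp_div_less)
    have bitk: "bit x k \<longleftrightarrow> x div 2 ^ k = 1"
      using div by (auto simp: bit_iff_odd less_2_cases_iff)
    have "{m \<in> {Suc n - Suc k..n}. bit x (n - m)} = (if bit x k then insert (n - k) ?X else ?X)"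
    proof -
      have "bit (x mod 2 ^ k) (n - m) \<longleftrightarrow> bit x (n - m)" if "m \<in> {Suc n - k..n}" for m
        using that Suc.prems by (auto simp: take_bit_eq_mod[symmetric] bit_take_bit_iff)
      moreover have "{Suc n - Suc k..n} = insert (n - k) {Suc n - k..n}"
        using Suc.prems by auto
      moreover have "n - (n - k) = k" using Suc.prems by simp
      ultimately show ?thesis by (auto split: if_splits)
    qed
    then have "chi S {m \<in> {Suc n - Suc k..n}. bit x (n - m)} =
        (if bit x k \<and> n - k \<in> S then -1 else 1) * chi S ?X"
      using Suc.prems by (auto simp: chi_def)
    moreover have "kronecker D T $$ (x, x) = D $$ (x div 2 ^ k, x div 2 ^ k) * T $$ (x mod 2 ^ k, x mod 2 ^ k)"
      using x by (simp add: kronecker_def D IH)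
    ultimately show ?thesis using diag[OF div] IH(3)[of "x mod 2 ^ k"] by (simp add: bitk)
  qed
  then show ?case unfolding T' by (simp add: kronecker_def D IH)
qed

lemma int_diag_pauli_Z_generator:
  assumes "x < 2 ^ n"
  shows "int_diag (pauli_Z_generator n S) x = chi S (support n x)"
proof -
  have "pauli_Z_generator n S $$ (x, x) = of_int (chi S (support n x))"
    using tensor_list_pauli[of n n S] assms by (simp add: pauli_Z_generator_def support_def)
  then show ?thesis by (simp add: int_diag_def)
qed

text \<open>The difference of the diagonal vectors at \<open>X\<close> and at \<open>{}\<close>; the
  latter belongs to index 0 and is constantly 1.\<close>

definition gen :: "nat \<Rightarrow> (nat \<Rightarrow> nat set) \<Rightarrow> nat set \<Rightarrow> int vec" where
  "gen N Q X = vec N (\<lambda>j. chi (Q (Suc j)) X - 1)"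

abbreviation gen_lattice :: "nat \<Rightarrow> nat \<Rightarrow> (nat \<Rightarrow> nat set) \<Rightarrow> int vec set" where
  "gen_lattice n N Q \<equiv> int_span N (gen N Q ` Pow {1..n})"

lemma gen_carrier [simp]: "gen N Q X \<in> carrier_vec N" "gen N Q ` A \<subseteq> carrier_vec N"
  by (auto simp: gen_def)

lemma gen_in_lattice: "X \<subseteq> {1..n} \<Longrightarrow> gen N Q X \<in> gen_lattice n N Q"
  by (rule int_span_base) auto

text \<open>Differences with the fixed base point \<open>{}\<close> suffice:
  \<open>k X - k Y = gen N Q X - gen N Q Y\<close>, and conversely
  \<open>gen N Q X = k X - k {}\<close>.\<close>

lemma lat_eq_gen_lattice: "lat (2 ^ n) N (\<lambda>j. pauli_Z_generator n (Q j)) = gen_lattice n N Q"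
proof -
  define k where "k X = vec N (\<lambda>j. chi (Q (Suc j)) X)" for X
  let ?H = "\<lambda>j. pauli_Z_generator n (Q j)"
  have "k_vector N ?H x = k (support n x)" if "x \<in> {0..<2 ^ n}" for x
    using that by (auto simp: k_vector_def k_def int_diag_pauli_Z_generator)
  then have "Omega (2 ^ n) N ?H = k ` support n ` {0..<2 ^ n}"
    unfolding Omega_def image_image by (intro image_cong refl)
  also have "support n ` {0..<2 ^ n} = Pow {1..n}"
    using bij_betw_support by (simp add: bij_betw_def)
  finally have Delta: "Delta (2 ^ n) N ?H = {k X - k Y | X Y. X \<subseteq> {1..n} \<and> Y \<subseteq> {1..n}}"
    unfolding Delta_def by auto
  have kX: "k X - k Y = gen N Q X + (-1) \<cdot>\<^sub>v gen N Q Y" for X Y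
    by (intro eq_vecI) (auto simp: k_def gen_def)
  have Dc: "Delta (2 ^ n) N ?H \<subseteq> carrier_vec N" unfolding Delta by (auto simp: kX)
  have "int_span N (Delta (2 ^ n) N ?H) \<subseteq> gen_lattice n N Q"
  proof (rule int_span_least)
    show "Delta (2 ^ n) N ?H \<subseteq> gen_lattice n N Q" unfolding Delta
      by (auto simp: kX simp del: One_nat_def intro!: int_span_add int_span_smult gen_in_lattice)
    show "gen_lattice n N Q \<subseteq> carrier_vec N" by (auto intro: int_span_carrier[rotated])
  qed (auto intro: int_span_add int_span_smult int_span_zero)
  moreover have "gen_lattice n N Q \<subseteq> int_span N (Delta (2 ^ n) N ?H)"
  proof (rule int_span_least)
    have "gen N Q X = k X - k {}" for X by (intro eq_vecI) (auto simp: k_def gen_def)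
    then show "gen N Q ` Pow {1..n} \<subseteq> int_span N (Delta (2 ^ n) N ?H)"
      by (auto intro!: int_span_base[OF Dc]) (auto simp: Delta)
    show "int_span N (Delta (2 ^ n) N ?H) \<subseteq> carrier_vec N" by (auto intro: int_span_carrier[OF Dc])
  qed (auto intro: int_span_add[OF Dc] int_span_smult[OF Dc] int_span_zero[OF Dc])
  ultimately show ?thesis unfolding lat_def by blast
qed

section \<open>Bounds on the lattice volume\<close>

lemma pauli_Z_circuitD:
  assumes "pauli_Z_circuit n N Q" "j < N"
  shows "Q (Suc j) \<subseteq> {1..n}" "Q (Suc j) \<noteq> {}"
    and "i < N \<Longrightarrow> Q (Suc i) = Q (Suc j) \<longleftrightarrow> i = j"
proof -
  have "Suc j \<in> {1..N}" "i < N \<Longrightarrow> Suc i \<in> {1..N}" using assms(2) by auto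
  then show "Q (Suc j) \<subseteq> {1..n}" "Q (Suc j) \<noteq> {}" "i < N \<Longrightarrow> Q (Suc i) = Q (Suc j) \<longleftrightarrow> i = j"
    using assms(1) unfolding pauli_Z_circuit_def inj_on_def by blast+
qed

text \<open>By orthogonality of the characters, the lattice contains 2^n Z^N.\<close>

lemma gen_lattice_full_rank:
  assumes Q: "pauli_Z_circuit n N Q"
  obtains T where "T \<in> carrier_mat N N" "det T \<noteq> 0" "\<And>i. i < N \<Longrightarrow> row T i \<in> gen_lattice n N Q"
proof
  let ?T = "2 ^ n \<cdot>\<^sub>m 1\<^sub>m N :: int mat"
  show "?T \<in> carrier_mat N N" "det ?T \<noteq> 0" by simp_all
  fix i assume i: "i < N"
  have "row ?T i = vec N (\<lambda>j. \<Sum>X\<in>Pow {1..n}. chi (Q (Suc i)) X * gen N Q X $ j)"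
  proof (rule eq_vecI)
    fix j assume "j < dim_vec (vec N (\<lambda>j. \<Sum>X\<in>Pow {1..n}. chi (Q (Suc i)) X * gen N Q X $ j))"
    then have j: "j < N" by simp
    \<comment> \<open>The constant 1 in \<open>gen\<close> is the trivial character
      \<open>chi {}\<close>. As \<open>Q (Suc i)\<close> is nonempty, orthogonality makes the second
      sum vanish, and the first leaves \<open>2 ^ n\<close> for \<open>j = i\<close> only.\<close>
    have "(\<Sum>X\<in>Pow {1..n}. chi (Q (Suc i)) X * gen N Q X $ j) =
        (\<Sum>X\<in>Pow {1..n}. chi (Q (Suc i)) X * chi (Q (Suc j)) X) -
        (\<Sum>X\<in>Pow {1..n}. chi (Q (Suc i)) X * chi {} X)"
      using j by (simp add: gen_def right_diff_distrib sum_subtractf)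
    also have "\<dots> = (if i = j then 2 ^ n else 0)"
      using pauli_Z_circuitD[OF Q i] pauli_Z_circuitD[OF Q j] i
      by (simp add: sum_chi_mult_chi del: One_nat_def chi_empty)
    finally show "row ?T i $ j = vec N (\<lambda>j. \<Sum>X\<in>Pow {1..n}. chi (Q (Suc i)) X * gen N Q X $ j) $ j"
      using i j by simp
  qed simp
  also have "\<dots> \<in> gen_lattice n N Q"
    by (rule int_span_sum) (auto simp del: One_nat_def intro: gen_in_lattice)
  finally show "row ?T i \<in> gen_lattice n N Q" .
qed

section \<open>Estimating the volume through determinants\<close>

lemma lattice_volume_eq:
  "is_basis_matrix N (gen_lattice n N Q) B \<Longrightarrow> lattice_volume n N Q = \<bar>det B\<bar>"
  by (simp add: lattice_volume_def lat_eq_gen_lattice covolume_eq)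

lemma gen_lattice_basis:
  assumes Q: "pauli_Z_circuit n N Q"
  obtains B where "is_basis_matrix N (gen_lattice n N Q) B" "det B \<noteq> 0"
proof -
  obtain T where T: "T \<in> carrier_mat N N" "det T \<noteq> 0" "\<And>i. i < N \<Longrightarrow> row T i \<in> gen_lattice n N Q"
    using gen_lattice_full_rank[OF Q] by blast
  show thesis using full_rank_basis_exists[OF gen_carrier(2) T that] .
qed

text \<open>The volume divides the determinant of any \<open>N\<close> lattice vectors, so a nonzero
  determinant bounds it from above.\<close>

lemma lattice_volume_le:
  assumes Q: "pauli_Z_circuit n N Q" and T: "T \<in> carrier_mat N N" "det T \<noteq> 0"
    and "\<And>i. i < N \<Longrightarrow> row T i \<in> gen_lattice n N Q"
  shows "lattice_volume n N Q \<le> \<bar>det T\<bar>"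
proof -
  obtain B where B: "is_basis_matrix N (gen_lattice n N Q) B" "det B \<noteq> 0"
    using gen_lattice_basis[OF Q] .
  have "det B dvd det T" by (rule is_basis_matrix_det_dvd[OF B(1) T(1) assms(4)])
  then show ?thesis using T(2) by (simp add: lattice_volume_eq[OF B(1)] dvd_imp_le_int)
qed

lemma det_double_rows:
  assumes B: "B \<in> carrier_mat N N" and B0: "\<And>i. i < N \<Longrightarrow> row B i = 2 \<cdot>\<^sub>v w i"
    and w: "\<And>i. i < N \<Longrightarrow> w i \<in> carrier_vec N"
  shows "det B = 2 ^ N * det (mat N N (\<lambda>(i, j). w i $ j) :: int mat)"
proof -
  have "B = 2 \<cdot>\<^sub>m mat N N (\<lambda>(i, j). w i $ j)"
  proof (rule eq_matI)
    fix i j assume "i < dim_row (2 \<cdot>\<^sub>m mat N N (\<lambda>(i, j). w i $ j))"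
      "j < dim_col (2 \<cdot>\<^sub>m mat N N (\<lambda>(i, j). w i $ j))"
    then have ij: "i < N" "j < N" by auto
    then have "B $$ (i, j) = row B i $ j" using B by auto
    then show "B $$ (i, j) = (2 \<cdot>\<^sub>m mat N N (\<lambda>(i, j). w i $ j)) $$ (i, j)"
      using ij w carrier_vecD[OF w[OF ij(1)]] by (simp add: B0)
  qed (use B in auto)
  then show ?thesis by simp
qed

text \<open>Over \<open>bit\<close>, \<open>y\<close> is a relation satisfied by all sums of rows of
  the binary matrix. Half of \<open>gen N Q X\<close> reduces modulo 2 to such a sum, and having a
  half that satisfies the relation is stable under integer combinations.\<close>

lemma gen_lattice_halves:
  assumes "v \<in> gen_lattice n N Q"
    and y: "\<And>X. X \<subseteq> {1..n} \<Longrightarrow> (\<Sum>j<N. y j * (\<Sum>m\<in>X. if m \<in> Q (Suc j) then 1 else 0)) = (0 :: bit)"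
  shows "\<exists>w \<in> carrier_vec N. v = 2 \<cdot>\<^sub>v w \<and> (\<Sum>j<N. y j * of_int (w $ j)) = (0 :: bit)"
proof -
  let ?W = "{v. \<exists>w \<in> carrier_vec N. v = 2 \<cdot>\<^sub>v w \<and> (\<Sum>j<N. y j * of_int (w $ j)) = (0 :: bit)}"
  have "gen_lattice n N Q \<subseteq> ?W"
  proof (rule int_span_least)
    show "gen N Q ` Pow {1..n} \<subseteq> ?W"
    proof clarify
      fix X assume X: "X \<subseteq> {1..n}"
      then have fX: "finite X" by (rule finite_subset) simp
      define p where "p j = (\<Sum>m\<in>X. if m \<in> Q (Suc j) then 1 else 0 :: bit)" for j
      \<comment> \<open>Half of a sign minus 1 is 0 or -1, and -1 becomes 1 in \<open>bit\<close>,
        so \<open>w\<close> reduces to \<open>p\<close>.\<close>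
      define w where "w = vec N (\<lambda>j. if p j = 0 then 0 else -1 :: int)"
      have "gen N Q X = 2 \<cdot>\<^sub>v w"
        by (intro eq_vecI) (auto simp: gen_def w_def p_def chi_parity[OF fX])
      moreover have "(\<Sum>j<N. y j * of_int (w $ j)) = (\<Sum>j<N. y j * p j)"
        by (intro sum.cong) (auto simp: w_def)
      ultimately show "\<exists>w \<in> carrier_vec N. gen N Q X = 2 \<cdot>\<^sub>v w \<and> (\<Sum>j<N. y j * of_int (w $ j)) = 0"
        using y[OF X] by (intro bexI[of _ w]) (auto simp: w_def p_def)
    qed
    have "(\<Sum>j<N. y j * of_int (0\<^sub>v N $ j)) = 0" by (intro sum.neutral) simp
    then show "0\<^sub>v N \<in> ?W" by (intro CollectI bexI[of _ "0\<^sub>v N"]) auto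
    show "u + v \<in> ?W" if uv: "u \<in> ?W" "v \<in> ?W" for u v
    proof -
      obtain w x where w: "w \<in> carrier_vec N" "u = 2 \<cdot>\<^sub>v w" "(\<Sum>j<N. y j * of_int (w $ j)) = 0"
        and x: "x \<in> carrier_vec N" "v = 2 \<cdot>\<^sub>v x" "(\<Sum>j<N. y j * of_int (x $ j)) = 0"
        using uv by blast
      have "(\<Sum>j<N. y j * of_int ((w + x) $ j)) =
          (\<Sum>j<N. y j * of_int (w $ j)) + (\<Sum>j<N. y j * of_int (x $ j))"
        using carrier_vecD[OF x(1)] unfolding sum.distrib[symmetric]
        by (intro sum.cong refl) (simp only: lessThan_iff index_add_vec of_int_add distrib_left)
      moreover have "u + v = 2 \<cdot>\<^sub>v (w + x)" using w x by (simp add: smult_add_distrib_vec)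
      ultimately show ?thesis using w x by (intro CollectI bexI[of _ "w + x"]) simp_all
    qed
    show "c \<cdot>\<^sub>v v \<in> ?W" if v: "v \<in> ?W" for c v
    proof -
      obtain w where w: "w \<in> carrier_vec N" "v = 2 \<cdot>\<^sub>v w" "(\<Sum>j<N. y j * of_int (w $ j)) = 0"
        using v by blast
      have "(\<Sum>j<N. y j * of_int ((c \<cdot>\<^sub>v w) $ j)) = of_int c * (\<Sum>j<N. y j * of_int (w $ j))"
        using carrier_vecD[OF w(1)] unfolding sum_distrib_left
        by (intro sum.cong refl) (simp only: lessThan_iff index_smult_vec of_int_mult mult.left_commute)
      moreover have "c \<cdot>\<^sub>v v = 2 \<cdot>\<^sub>v (c \<cdot>\<^sub>v w)" using w by (simp add: smult_smult_assoc mult.commute)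
      ultimately show ?thesis using w by (intro CollectI bexI[of _ "c \<cdot>\<^sub>v w"]) simp_all
    qed
  qed auto
  then show ?thesis using assms(1) by blast
qed

lemma lattice_volume_ge:
  assumes Q: "pauli_Z_circuit n N Q"
  shows "2 ^ N \<le> lattice_volume n N Q"
proof -
  obtain B where B: "is_basis_matrix N (gen_lattice n N Q) B" "det B \<noteq> 0"
    using gen_lattice_basis[OF Q] .
  \<comment> \<open>The relation with all coefficients 0 leaves only the evenness of the rows, which
    yields a factor 2 of the determinant per row.\<close>
  have "\<exists>w \<in> carrier_vec N. row B i = 2 \<cdot>\<^sub>v w" if "i < N" for i
    using gen_lattice_halves[OF is_basis_matrix_rows[OF B(1) that], of "\<lambda>_. 0"] by auto
  then obtain w where "\<And>i. i < N \<Longrightarrow> w i \<in> carrier_vec N" "\<And>i. i < N \<Longrightarrow> row B i = 2 \<cdot>\<^sub>v w i"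
    by metis
  then have "det B = 2 ^ N * det (mat N N (\<lambda>(i, j). w i $ j))"
    using B(1) by (intro det_double_rows) (auto simp: is_basis_matrix_def)
  then have "2 ^ N dvd det B" by simp
  then show ?thesis using dvd_imp_le_int[OF B(2)] by (fastforce simp: lattice_volume_eq[OF B(1)])
qed

section \<open>Sign matrices and the upper bound\<close>

definition sign_matrix :: "nat \<Rightarrow> (nat \<Rightarrow> nat set) \<Rightarrow> (nat \<Rightarrow> nat set) \<Rightarrow> int mat" where
  "sign_matrix N Q X = mat (Suc N) (Suc N) (\<lambda>(i, j). chi (if j = 0 then {} else Q j) (X i))"

text \<open>Column 0 of the sign matrix stands for the empty set and is constantly 1, and
  \<open>X 0 = {}\<close> makes row 0 constantly 1 too. Subtracting row 0 from the other rows
  therefore produces the vectors \<open>gen\<close>.\<close>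

lemma det_gen_eq_det_sign_matrix:
  assumes "X 0 = {}"
  shows "det (mat N N (\<lambda>(i, j). gen N Q (X (Suc i)) $ j)) = det (sign_matrix N Q X)"
proof -
  have "mat N N (\<lambda>(i, j). gen N Q (X (Suc i)) $ j) = mat N N
      (\<lambda>(i, j). sign_matrix N Q X $$ (Suc i, Suc j) - sign_matrix N Q X $$ (0, Suc j))"
    using assms by (intro eq_matI) (auto simp: gen_def sign_matrix_def)
  then show ?thesis
    using det_subtract_first_row[of "sign_matrix N Q X" N] by (simp add: sign_matrix_def)
qed

text \<open>All entries are 1 or -1, so every row has squared length \<open>N + 1\<close> in
  Hadamard's inequality.\<close>

lemma det_sign_matrix_square_le:
  assumes "\<And>i. i \<le> N \<Longrightarrow> finite (X i)"
  shows "(det (sign_matrix N Q X))\<^sup>2 \<le> (int N + 1) ^ (N + 1)"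
proof -
  let ?M = "map_mat real_of_int (sign_matrix N Q X)"
  have "(det ?M)\<^sup>2 \<le> (\<Prod>i<Suc N. \<Sum>k<Suc N. (?M $$ (i, k))\<^sup>2)"
    by (rule hadamard_inequality) (simp add: sign_matrix_def)
  also have "\<dots> = (\<Prod>i<Suc N. \<Sum>k<Suc N. 1)"
  proof (intro prod.cong sum.cong refl)
    fix i k assume "i \<in> {..<Suc N}" "k \<in> {..<Suc N}"
    then have "(?M $$ (i, k))\<^sup>2 = real_of_int ((chi (if k = 0 then {} else Q k) (X i))\<^sup>2)"
      by (simp add: sign_matrix_def)
    also have "\<dots> = 1" using assms \<open>i \<in> {..<Suc N}\<close> by (subst chi_square) auto
    finally show "(?M $$ (i, k))\<^sup>2 = 1" .
  qed
  also have "\<dots> = real_of_int ((int N + 1) ^ (N + 1))" by (simp add: add.commute)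
  finally show ?thesis
    unfolding of_int_hom.hom_det of_int_power[symmetric] of_int_le_iff .
qed

text \<open>The bound is squared because \<open>(N + 1) / 2\<close> need not be an integer. Exchange
  turns a full-rank tuple of lattice vectors into one of generators, whose determinant is that of a
  sign matrix.\<close>

lemma lattice_volume_square_le:
  assumes Q: "pauli_Z_circuit n N Q"
  shows "(lattice_volume n N Q)\<^sup>2 \<le> (int N + 1) ^ (N + 1)"
proof -
  obtain T where T: "T \<in> carrier_mat N N" "det T \<noteq> 0" "\<And>i. i < N \<Longrightarrow> row T i \<in> gen_lattice n N Q"
    using gen_lattice_full_rank[OF Q] by blast
  obtain B where B: "B \<in> carrier_mat N N" "det B \<noteq> 0" "\<And>i. i < N \<Longrightarrow> row B i \<in> gen N Q ` Pow {1..n}"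
    using exchange_rows[OF gen_carrier(2) T] by blast
  have "\<exists>Y \<subseteq> {1..n}. row B i = gen N Q Y" if "i < N" for i using B(3)[OF that] by blast
  then obtain Y where Y: "\<And>i. i < N \<Longrightarrow> Y i \<subseteq> {1..n} \<and> row B i = gen N Q (Y i)" by metis
  \<comment> \<open>The sets are shifted by one to make room for the empty set at index 0.\<close>
  define X where "X i = (case i of 0 \<Rightarrow> {} | Suc i \<Rightarrow> Y i)" for i
  have "B = mat N N (\<lambda>(i, j). gen N Q (X (Suc i)) $ j)"
  proof (rule eq_matI)
    fix i j assume "i < dim_row (mat N N (\<lambda>(i, j). gen N Q (X (Suc i)) $ j))"
      "j < dim_col (mat N N (\<lambda>(i, j). gen N Q (X (Suc i)) $ j))"
    then have ij: "i < N" "j < N" by auto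
    then have "B $$ (i, j) = row B i $ j" using B by auto
    then show "B $$ (i, j) = mat N N (\<lambda>(i, j). gen N Q (X (Suc i)) $ j) $$ (i, j)"
      using ij Y by (simp add: X_def)
  qed (use B in auto)
  then have det: "det B = det (sign_matrix N Q X)"
    using det_gen_eq_det_sign_matrix[of X N Q] by (simp add: X_def)
  have "finite (X i)" if "i \<le> N" for i
    using that by (cases i) (auto simp: X_def intro: finite_subset[OF conjunct1[OF Y]])
  then have "(det B)\<^sup>2 \<le> (int N + 1) ^ (N + 1)" unfolding det by (rule det_sign_matrix_square_le)
  moreover have "(lattice_volume n N Q)\<^sup>2 \<le> \<bar>det B\<bar>\<^sup>2"
  proof (rule power_mono)
    show "lattice_volume n N Q \<le> \<bar>det B\<bar>"
      using B by (intro lattice_volume_le[OF Q]) (auto intro: int_span_base)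
    show "0 \<le> lattice_volume n N Q"
      using lattice_volume_ge[OF Q] by (meson order_trans zero_le_numeral zero_le_power)
  qed
  ultimately show ?thesis by simp
qed

text \<open>For \<open>N + 1 = 2 ^ n\<close> the rows of the sign matrix can run through all sets of
  qubits, and orthogonality of its columns fixes the determinant up to sign. The \<open>N\<close>
  vectors \<open>gen\<close> of the nonempty sets generate the lattice and have nonzero determinant,
  so they form a basis.\<close>

lemma lattice_volume_square_all_rotations:
  assumes Q: "pauli_Z_circuit n N Q" and N: "N = 2 ^ n - 1"
  shows "(lattice_volume n N Q)\<^sup>2 = (2 ^ n) ^ 2 ^ n"
proof -
  define M where "M = sign_matrix N Q (support n)"
  have SN: "Suc N = 2 ^ n" using N by simp
  have Mc: "M \<in> carrier_mat (Suc N) (Suc N)" by (simp add: M_def sign_matrix_def)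
  let ?Q = "\<lambda>j. if j = 0 then {} else Q j"
  have Q_sub: "?Q j \<subseteq> {1..n}" if "j < Suc N" for j
    using that pauli_Z_circuitD(1)[OF Q] by (cases j) (simp_all del: One_nat_def)
  \<comment> \<open>Index 0 stands for the empty set, which differs from the other sets because
    those are nonempty.\<close>
  have Q_eq: "?Q i = ?Q j \<longleftrightarrow> i = j" if "i < Suc N" "j < Suc N" for i j
    using that pauli_Z_circuitD(2)[OF Q] pauli_Z_circuitD(3)[OF Q] by (cases i; cases j) force+
  have "M\<^sup>T * M = 2 ^ n \<cdot>\<^sub>m 1\<^sub>m (Suc N)"
  proof (rule eq_matI)
    fix i j assume "i < dim_row (2 ^ n \<cdot>\<^sub>m 1\<^sub>m (Suc N) :: int mat)" "j < dim_col (2 ^ n \<cdot>\<^sub>m 1\<^sub>m (Suc N) :: int mat)"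
    then have ij: "i < Suc N" "j < Suc N" by auto
    have "(M\<^sup>T * M) $$ (i, j) = (\<Sum>x\<in>{0..<2 ^ n}. chi (?Q i) (support n x) * chi (?Q j) (support n x))"
      using ij by (simp add: M_def sign_matrix_def scalar_prod_def SN)
    also have "\<dots> = (\<Sum>X\<in>Pow {1..n}. chi (?Q i) X * chi (?Q j) X)"
      by (rule sum.reindex_bij_betw[OF bij_betw_support])
    also have "\<dots> = (if ?Q i = ?Q j then 2 ^ card {1..n} else 0)"
      by (intro sum_chi_mult_chi Q_sub ij) simp
    also have "\<dots> = (2 ^ n \<cdot>\<^sub>m 1\<^sub>m (Suc N)) $$ (i, j)"
      using ij unfolding Q_eq[OF ij] by simp
    finally show "(M\<^sup>T * M) $$ (i, j) = (2 ^ n \<cdot>\<^sub>m 1\<^sub>m (Suc N)) $$ (i, j)" .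
  qed (use Mc in auto)
  then have "det (M\<^sup>T * M) = (2 ^ n) ^ Suc N" by simp
  then have det: "(det M)\<^sup>2 = (2 ^ n) ^ 2 ^ n"
    using Mc unfolding SN by (simp add: det_mult[of _ "Suc N"] det_transpose SN power2_eq_square)
  define B where "B = mat N N (\<lambda>(i, j). gen N Q (support n (Suc i)) $ j)"
  have Bc: "B \<in> carrier_mat N N" by (simp add: B_def)
  have det_B: "det B = det M" by (simp add: B_def M_def det_gen_eq_det_sign_matrix)
  have row: "row B i = gen N Q (support n (Suc i))" if "i < N" for i
    using that by (intro eq_vecI) (auto simp: B_def gen_def)
  have Br: "set (rows B) \<subseteq> carrier_vec N" using Bc by (auto simp: rows_def)
  have "int_span N (set (rows B)) = gen_lattice n N Q"
  proof
    show "int_span N (set (rows B)) \<subseteq> gen_lattice n N Q"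
    proof (rule int_span_least)
      show "set (rows B) \<subseteq> gen_lattice n N Q"
        using Bc by (auto simp: rows_def row support_def simp del: One_nat_def intro!: gen_in_lattice)
    qed (auto intro: int_span_add int_span_smult int_span_zero int_span_carrier[rotated])
    show "gen_lattice n N Q \<subseteq> int_span N (set (rows B))"
    proof (rule int_span_least)
      show "gen N Q ` Pow {1..n} \<subseteq> int_span N (set (rows B))"
      proof clarify
        fix X assume "X \<subseteq> {1..n}"
        then have "X \<in> support n ` {0..<2 ^ n}" using bij_betw_support[of n] by (simp add: bij_betw_def)
        then obtain x where x: "x < Suc N" "X = support n x" by (auto simp: SN)
        \<comment> \<open>Index 0 has no row in \<open>B\<close>, but its vector is zero.\<close>
        show "gen N Q X \<in> int_span N (set (rows B))"
        proof (cases x)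
          case 0
          then have "gen N Q X = 0\<^sub>v N" by (auto simp: x gen_def zero_vec_def)
          then show ?thesis using int_span_zero[OF Br] by simp
        next
          case (Suc i)
          then have "gen N Q X \<in> set (rows B)"
            using x row[of i] Bc by (auto simp: rows_def image_iff intro!: bexI[of _ i])
          then show ?thesis by (rule int_span_base[OF Br])
        qed
      qed
    qed (auto intro: int_span_add[OF Br] int_span_smult[OF Br] int_span_zero[OF Br] int_span_carrier[OF Br])
  qed
  moreover have "det B \<noteq> 0" using det det_B by auto
  ultimately have "is_basis_matrix N (gen_lattice n N Q) B" using Bc by (intro is_basis_matrixI)
  then show ?thesis using det det_B by (simp add: lattice_volume_eq)
qed

section \<open>The minimal volume and the rank modulo 2\<close>

lemma lattice_volume_eq_V_min_if_det:
  assumes Q: "pauli_Z_circuit n n Q" and det: "det (binary_matrix n n Q) \<noteq> 0"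
  shows "lattice_volume n n Q = 2 ^ n"
proof -
  let ?A = "binary_matrix n n Q"
  have Ac: "?A \<in> carrier_mat n n" by (simp add: binary_matrix_def)
  have row: "row (-2 \<cdot>\<^sub>m 1\<^sub>m n :: int mat) i \<in> gen_lattice n n Q" if i: "i < n" for i
  proof -
    \<comment> \<open>Over \<open>bit\<close> a nonzero determinant is 1, so the adjugate is the
      inverse. Its row \<open>i\<close> selects rows of the binary matrix whose sum is the
      \<open>i\<close>-th unit vector, and then \<open>gen n Q X\<close> is -2 times that unit
      vector. Qubits count from 1, hence \<open>m - 1\<close>.\<close>
    define X where "X = {m \<in> {1..n}. adj_mat ?A $$ (i, m - 1) = 1}"
    have "(\<Sum>m\<in>X. if m \<in> Q (Suc j) then 1 else 0 :: bit) = (if i = j then 1 else 0)" if j: "j < n" for j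
    proof -
      have "(adj_mat ?A * ?A) $$ (i, j) = (\<Sum>m<n. adj_mat ?A $$ (i, m) * ?A $$ (m, j))"
        using i j Ac adj_mat(1)[OF Ac] by (auto simp: scalar_prod_def lessThan_atLeast0)
      also have "\<dots> = (\<Sum>m\<in>{1..n}. adj_mat ?A $$ (i, m - 1) * ?A $$ (m - 1, j))"
        by (rule sum.reindex_bij_witness[of _ "\<lambda>m. m - 1" Suc]) auto
      also have "\<dots> = (\<Sum>m\<in>{1..n}. if m \<in> X then (if m \<in> Q (Suc j) then 1 else 0) else 0)"
        using j by (intro sum.cong) (auto simp: X_def binary_matrix_def)
      also have "\<dots> = (\<Sum>m\<in>X. if m \<in> Q (Suc j) then 1 else 0)"
        by (subst sum.inter_filter[symmetric]) (auto simp: X_def intro!: sum.cong)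
      finally have "(\<Sum>m\<in>X. if m \<in> Q (Suc j) then 1 else 0) = (adj_mat ?A * ?A) $$ (i, j)" ..
      also have "\<dots> = (if i = j then 1 else 0)"
        unfolding adj_mat(3)[OF Ac] using i j det by simp
      finally show ?thesis .
    qed
    then have "gen n Q X = row (-2 \<cdot>\<^sub>m 1\<^sub>m n) i"
      using i by (intro eq_vecI) (auto simp: gen_def chi_parity X_def)
    moreover have "X \<subseteq> {1..n}" by (auto simp: X_def)
    ultimately show ?thesis using gen_in_lattice[of X n n Q] by simp
  qed
  have "lattice_volume n n Q \<le> \<bar>det (-2 \<cdot>\<^sub>m 1\<^sub>m n :: int mat)\<bar>"
    by (rule lattice_volume_le[OF Q]) (simp_all only: row, simp_all)
  also have "\<dots> = 2 ^ n" by (simp add: power_abs)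
  finally show ?thesis using lattice_volume_ge[OF Q] by simp
qed

text \<open>A nonzero \<open>y\<close> in the kernel modulo 2 is a relation for the halves of all
  lattice vectors, so the halved basis is singular modulo 2. But volume \<open>2 ^ n\<close> makes
  its determinant 1 or -1, which is odd.\<close>

lemma det_binary_matrix_if_lattice_volume:
  assumes Q: "pauli_Z_circuit n n Q" and vol: "lattice_volume n n Q = 2 ^ n"
  shows "det (binary_matrix n n Q) \<noteq> 0"
proof
  let ?A = "binary_matrix n n Q"
  have Ac: "?A \<in> carrier_mat n n" by (simp add: binary_matrix_def)
  assume "det ?A = 0"
  then obtain y where y: "y \<in> carrier_vec n" "y \<noteq> 0\<^sub>v n" "?A *\<^sub>v y = 0\<^sub>v n"
    using det_0_iff_vec_prod_zero[OF Ac] by blast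
  have "(\<Sum>j<n. y $ j * (\<Sum>m\<in>X. if m \<in> Q (Suc j) then 1 else 0)) = (0 :: bit)" if X: "X \<subseteq> {1..n}" for X
  proof -
    have "(\<Sum>j<n. y $ j * (if m \<in> Q (Suc j) then 1 else 0)) = 0" if m: "m \<in> X" for m
    proof -
      have "m \<in> {1..n}" using m X by blast
      then have m': "m - 1 < n" "Suc (m - 1) = m" by auto
      have "(\<Sum>j<n. y $ j * (if m \<in> Q (Suc j) then 1 else 0)) = (?A *\<^sub>v y) $ (m - 1)"
        using m' y(1) by (auto simp: binary_matrix_def scalar_prod_def lessThan_atLeast0 intro!: sum.cong)
      then show ?thesis using y(3) m' by simp
    qed
    then have "(\<Sum>m\<in>X. \<Sum>j<n. y $ j * (if m \<in> Q (Suc j) then 1 else 0)) = 0" by simp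
    then show ?thesis unfolding sum_distrib_left by (subst sum.swap)
  qed
  note halves = gen_lattice_halves[OF _ this]
  obtain B where B: "is_basis_matrix n (gen_lattice n n Q) B" "det B \<noteq> 0"
    using gen_lattice_basis[OF Q] .
  have "\<exists>w \<in> carrier_vec n. row B i = 2 \<cdot>\<^sub>v w \<and> (\<Sum>j<n. y $ j * of_int (w $ j)) = 0" if "i < n" for i
    using halves is_basis_matrix_rows[OF B(1) that] by blast
  then obtain w where w: "\<And>i. i < n \<Longrightarrow> w i \<in> carrier_vec n" "\<And>i. i < n \<Longrightarrow> row B i = 2 \<cdot>\<^sub>v w i"
    "\<And>i. i < n \<Longrightarrow> (\<Sum>j<n. y $ j * of_int (w i $ j)) = 0"
    by metis
  define W where "W = mat n n (\<lambda>(i, j). w i $ j)"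
  have "det B = 2 ^ n * det W"
    unfolding W_def using B(1) w by (intro det_double_rows) (auto simp: is_basis_matrix_def)
  then have "\<bar>det W\<bar> = 1" using vol by (simp add: lattice_volume_eq[OF B(1)] abs_mult)
  then have "of_int (det W) = (1 :: bit)" by (cases "det W \<ge> 0") auto
  moreover have "det (map_mat of_int W :: bit mat) = 0"
  proof -
    have "(map_mat of_int W *\<^sub>v y) $ i = 0" if i: "i < n" for i
    proof -
      have "(map_mat of_int W *\<^sub>v y) $ i = row (map_mat of_int W) i \<bullet> y"
        using i by (simp add: W_def)
      also have "\<dots> = (\<Sum>j<n. y $ j * of_int (w i $ j))"
        unfolding scalar_prod_def carrier_vecD[OF y(1)] lessThan_atLeast0
        by (intro sum.cong refl) (use i in \<open>auto simp: W_def mult.commute\<close>)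
      finally show ?thesis using w(3)[OF i] by (simp only:)
    qed
    then have "map_mat of_int W *\<^sub>v y = 0\<^sub>v n" by (intro eq_vecI) (auto simp: W_def)
    then show ?thesis
      using y det_0_iff_vec_prod_zero[of "map_mat of_int W :: bit mat" n] by (auto simp: W_def)
  qed
  ultimately show False by (simp add: of_int_hom.hom_det)
qed

text \<open>One rotation on each qubit: the binary matrix is the identity.\<close>

lemma singleton_circuit:
  "pauli_Z_circuit n n (\<lambda>j. {j}) \<and> lattice_volume n n (\<lambda>j. {j}) = 2 ^ n"
proof
  show Q: "pauli_Z_circuit n n (\<lambda>j. {j})" by (auto simp: pauli_Z_circuit_def)
  have "binary_matrix n n (\<lambda>j. {j}) = 1\<^sub>m n" by (intro eq_matI) (auto simp: binary_matrix_def)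
  then show "lattice_volume n n (\<lambda>j. {j}) = 2 ^ n" using lattice_volume_eq_V_min_if_det[OF Q] by simp
qed

text \<open>For \<open>N > n\<close> the lower bound \<open>2 ^ N\<close> already exceeds
  \<open>V_min n\<close>; for \<open>N = n\<close> full rank means a nonzero determinant.\<close>

lemma lattice_volume_eq_V_min_iff:
  assumes Q: "pauli_Z_circuit n N Q" and "n \<le> N"
  shows "lattice_volume n N Q = V_min n \<longleftrightarrow> N = n \<and> vec_space.rank n (binary_matrix n N Q) = n"
proof -
  have rank: "vec_space.rank n (binary_matrix n n Q) = n \<longleftrightarrow> det (binary_matrix n n Q) \<noteq> 0"
    by (rule vec_space.det_rank_iff[symmetric]) (simp add: binary_matrix_def)
  show ?thesis
  proof (cases "N = n")
    case True
    then show ?thesis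
      using Q lattice_volume_eq_V_min_if_det[of n Q] det_binary_matrix_if_lattice_volume[of n Q]
      by (auto simp: V_min_def rank)
  next
    case False
    then have "(2 :: int) ^ n < 2 ^ N" using assms(2) by simp
    then show ?thesis using False lattice_volume_ge[OF Q] by (auto simp: V_min_def)
  qed
qed

text \<open>Brings \<open>V_max\<close> into the form of the middle bound, so that monotonicity of
  \<open>powr\<close> compares the two; \<open>1 \<le> n\<close> makes \<open>2 ^ (n - 1)\<close>
  half of \<open>2 ^ n\<close>.\<close>

lemma V_max_eq_powr: "1 \<le> n \<Longrightarrow> real_of_int (V_max n) = (2 ^ n) powr (2 ^ n / 2)"
proof -
  assume "1 \<le> n"
  then have "(2 :: real) ^ n / 2 = real (2 ^ (n - 1))" by (cases n) simp_all
  then have "((2 :: real) ^ n) powr (2 ^ n / 2) = (2 ^ n) powr real (2 ^ (n - 1))" by (simp only:)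
  also have "\<dots> = (2 ^ n) ^ 2 ^ (n - 1)" by (rule powr_realpow) simp
  finally show ?thesis by (simp only: V_max_def of_int_power of_int_numeral)
qed

theorem theorem4:
  fixes n N :: nat and Q :: "nat \<Rightarrow> nat set"
  assumes "1 \<le> n" and "n \<le> N" and "N \<le> 2 ^ n - 1"
    and "pauli_Z_circuit n N Q"
  shows "V_min n \<le> 2 ^ N
    \<and> 2 ^ N \<le> lattice_volume n N Q
    \<and> real_of_int (lattice_volume n N Q) \<le> (real N + 1) powr ((real N + 1) / 2)
    \<and> (real N + 1) powr ((real N + 1) / 2) \<le> real_of_int (V_max n)
    \<and> (N = 2 ^ n - 1 \<longrightarrow> lattice_volume n N Q = V_max n)
    \<and> (\<exists>Q'. pauli_Z_circuit n n Q' \<and> lattice_volume n n Q' = V_min n)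
    \<and> (lattice_volume n N Q = V_min n \<longleftrightarrow>
         N = n \<and> vec_space.rank n (binary_matrix n N Q) = n)"
proof (intro conjI)
  let ?V = "lattice_volume n N Q"
  note Q = assms(4)
  show "V_min n \<le> 2 ^ N" using assms(2) by (simp add: V_min_def)
  show ge: "2 ^ N \<le> ?V" by (rule lattice_volume_ge[OF Q])
  have pos: "0 < ?V" using ge by (meson less_le_trans zero_less_numeral zero_less_power)
  \<comment> \<open>Squaring clears the fraction in the exponent, so that the integer bound
    applies.\<close>
  show "real_of_int ?V \<le> (real N + 1) powr ((real N + 1) / 2)"
  proof (rule power2_le_imp_le)
    have "(real_of_int ?V)\<^sup>2 = real_of_int (?V\<^sup>2)" by simp
    also have "\<dots> \<le> real_of_int ((int N + 1) ^ (N + 1))"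
      using lattice_volume_square_le[OF Q] by (simp only: of_int_le_iff)
    also have "\<dots> = (real N + 1) powr real (N + 1)" by (subst powr_realpow) auto
    also have "real (N + 1) = (real N + 1) / 2 + (real N + 1) / 2" by simp
    also have "(real N + 1) powr \<dots> = ((real N + 1) powr ((real N + 1) / 2))\<^sup>2"
      by (simp only: powr_add power2_eq_square)
    finally show "(real_of_int ?V)\<^sup>2 \<le> ((real N + 1) powr ((real N + 1) / 2))\<^sup>2" .
  qed simp
  have "N + 1 \<le> 2 ^ n" using assms(3) one_le_power[of "2 :: nat" n] by linarith
  then have "real (N + 1) \<le> real (2 ^ n)" by (simp only: of_nat_le_iff)
  then have N: "real N + 1 \<le> 2 ^ n" by simp
  have "(real N + 1) powr ((real N + 1) / 2) \<le> (2 ^ n) powr ((real N + 1) / 2)"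
    using N by (intro powr_mono2) auto
  also have "\<dots> \<le> (2 ^ n) powr (2 ^ n / 2)" using N by (intro powr_mono) auto
  finally show "(real N + 1) powr ((real N + 1) / 2) \<le> real_of_int (V_max n)"
    using assms(1) by (simp add: V_max_eq_powr)
  show "N = 2 ^ n - 1 \<longrightarrow> ?V = V_max n"
  proof
    assume "N = 2 ^ n - 1"
    then have "?V\<^sup>2 = (2 ^ n) ^ 2 ^ n" by (rule lattice_volume_square_all_rotations[OF Q])
    \<comment> \<open>Splitting the exponent exhibits the right-hand side as the square of
      \<open>V_max n\<close>; both roots are nonnegative.\<close>
    also have "(2 :: nat) ^ n = 2 ^ (n - 1) * 2" using assms(1) by (cases n) simp_all
    also have "(2 ^ n) ^ \<dots> = (V_max n)\<^sup>2" by (simp only: V_max_def power_mult)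
    finally show "?V = V_max n" using pos by (simp add: power2_eq_iff_nonneg V_max_def)
  qed
  show "\<exists>Q'. pauli_Z_circuit n n Q' \<and> lattice_volume n n Q' = V_min n"
    using singleton_circuit by (auto simp: V_min_def)
  show "?V = V_min n \<longleftrightarrow> N = n \<and> vec_space.rank n (binary_matrix n N Q) = n"
    by (rule lattice_volume_eq_V_min_iff[OF Q assms(2)])
qed

end
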